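(* Let $n\ge 1$, $w\in\mathbb{R}^n_{>0}$, $1/2\le\beta<1$, $c_0\in\mathbb{R}^n$, $r_0>0$, $B_0=\mathcal{B}(c_0,r_0w)$, and $x^*\in B_0$. If $f\in\mathcal{U}(x^*,B_0)$, then for every tie rule the sequence generated by Cube-Sign$(\beta,w)$ from the initial box $B_0$ satisfies, for all $k\ge 0$, $$x^*\in\mathcal{B}(c_k,r_k),\qquad M_k\le R_k=\beta^k r_0 .$$ Consequently, for $0<\varepsilon<r_0$, $K=\lceil \log(r_0/\varepsilon)/\log(1/\beta)\rceil$ steps suffice for $M_K\le\varepsilon$.
   Context: Vector inequalities, products $\odot$ are componentwise. For $c\in\mathbb{R}^n$ and $r\in\mathbb{R}^n_{>0}$, $\mathcal{B}(c,r)=\{x:|x_i-c_i|\le r_i,\ i=1,\dots,n\}$. $\|u\|_{\infty,w}=\max_i|u_i|/w_i$. Algorithm Cube-Sign$(\beta,w)$: from $c_0$, $r_0>0$, put $R_k=\beta^kr_0$, $r_k=R_kw$. At step $k$ take $s_k\in\{-1,+1\}^n$ with $s_{k,i}=\operatorname{sign}\partial_if(c_k)$ whenever $\partial_if(c_k)\ne0$; if $\partial_if(c_k)=0$, $s_{k,i}\in\{-1,+1\}$ is chosen by a tie rule (any rule depending only on query points, sign answers and previous choices). Then $c_{k+1}=c_k-(1-\beta)R_k\,w\odot s_k$. The initial box is $\mathcal{B}(c_0,r_0w)$. $M_k=\|c_k-x^*\|_{\infty,w}$. Class $\mathcal{U}(x^*,B)$ (for $x^*\in B$): functions $f$ differentiable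 (on a neighbourhood of the closed box $B$) such that $\partial_if(x)(x_i-x_i^* )>0$ for every $x\in B$ and every $i$ with $x_i\ne x_i^*$. *)

theory Defs
  imports "HOL-Analysis.Analysis"
begin

definition centered_box :: "real ^ 'n \<Rightarrow> real ^ 'n \<Rightarrow> (real ^ 'n) set" where
  "centered_box c r = {x. \<forall>i. \<bar>x $ i - c $ i\<bar> \<le> r $ i}"

definition weighted_sup_norm :: "real ^ 'n \<Rightarrow> real ^ 'n \<Rightarrow> real" where
  "weighted_sup_norm w u = (MAX i. \<bar>u $ i\<bar> / w $ i)"

definition partial_deriv :: "'n \<Rightarrow> (real ^ 'n \<Rightarrow> real) \<Rightarrow> real ^ 'n \<Rightarrow> real" where
  "partial_deriv i f x = deriv (\<lambda>t. f (x + t *\<^sub>R axis i 1)) 0"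

text \<open>Functions are total; only their values on some open neighbourhood of \<open>B\<close> matter.\<close>

definition class_U :: "real ^ 'n \<Rightarrow> (real ^ 'n) set \<Rightarrow> (real ^ 'n \<Rightarrow> real) set" where
  "class_U xs B =
     {f. (\<exists>V. open V \<and> B \<subseteq> V \<and> f differentiable_on V) \<and>
         (\<forall>x\<in>B. \<forall>i. x $ i \<noteq> xs $ i \<longrightarrow> partial_deriv i f x * (x $ i - xs $ i) > 0)}"

definition sign_answers :: "(real ^ 'n \<Rightarrow> real) \<Rightarrow> real ^ 'n \<Rightarrow> real ^ 'n" where
  "sign_answers f x = (\<chi> i. sgn (partial_deriv i f x))"

text \<open>A history lists, oldest first, the triples (query point, sign answers, chosen sign vector)
  of the completed steps. A tie rule maps the history, the current query point and the current
  sign answers to a vector with entries \<open>-1\<close> or \<open>1\<close>; its \<open>i\<close>-th entry is used only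
  if the \<open>i\<close>-th current answer is \<open>0\<close>.\<close>

type_synonym 'n history = "((real ^ 'n) \<times> (real ^ 'n) \<times> (real ^ 'n)) list"

type_synonym 'n tie_fun = "'n history \<Rightarrow> real ^ 'n \<Rightarrow> real ^ 'n \<Rightarrow> real ^ 'n"

definition tie_rule :: "'n::finite tie_fun \<Rightarrow> bool" where
  "tie_rule tie \<longleftrightarrow> (\<forall>h c a i. tie h c a $ i \<in> {-1, 1})"

definition choose_signs ::
  "'n::finite tie_fun \<Rightarrow> 'n history \<Rightarrow> real ^ 'n \<Rightarrow> real ^ 'n \<Rightarrow> real ^ 'n" where
  "choose_signs tie h c a = (\<chi> i. if a $ i \<noteq> 0 then a $ i else tie h c a $ i)"

definition cube_radius :: "real \<Rightarrow> real \<Rightarrow> nat \<Rightarrow> real" where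
  "cube_radius \<beta> r0 k = \<beta> ^ k * r0"

text \<open>The state before step \<open>k\<close> is the history together with the current centre.
  The product \<open>w * s\<close> of vectors is componentwise.\<close>

primrec cube_sign_state ::
  "real \<Rightarrow> real ^ 'n::finite \<Rightarrow> 'n tie_fun \<Rightarrow> (real ^ 'n \<Rightarrow> real) \<Rightarrow> real ^ 'n \<Rightarrow> real
    \<Rightarrow> nat \<Rightarrow> 'n history \<times> (real ^ 'n)" where
  "cube_sign_state \<beta> w tie f c0 r0 0 = ([], c0)"
| "cube_sign_state \<beta> w tie f c0 r0 (Suc k) =
     (let (h, c) = cube_sign_state \<beta> w tie f c0 r0 k;
          a = sign_answers f c;
          s = choose_signs tie h c a
      in (h @ [(c, a, s)], c - ((1 - \<beta>) * cube_radius \<beta> r0 k) *\<^sub>R (w * s)))"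

definition cube_sign ::
  "real \<Rightarrow> real ^ 'n::finite \<Rightarrow> 'n tie_fun \<Rightarrow> (real ^ 'n \<Rightarrow> real) \<Rightarrow> real ^ 'n \<Rightarrow> real
    \<Rightarrow> nat \<Rightarrow> real ^ 'n" where
  "cube_sign \<beta> w tie f c0 r0 k = snd (cube_sign_state \<beta> w tie f c0 r0 k)"

end

theory Submission imports Defs begin

text \<open>Everything happens coordinatewise. Where the centre differs from the minimiser in
  coordinate \<open>i\<close>, the class condition makes the sign answer equal to the sign of the
  error \<open>d\<close>, so the update subtracts \<open>(1 - \<beta>) R w\<^sub>i\<close> from \<open>\<bar>d\<bar> \<le> R w\<^sub>i\<close>; for
  \<open>d > 0\<close> the result lies between \<open>- (1 - \<beta>) R w\<^sub>i\<close> and \<open>\<beta> R w\<^sub>i\<close>, and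
  the case \<open>d < 0\<close> is its mirror image. Where the two agree, the chosen sign is
  arbitrary, but the new error is \<open>(1 - \<beta>) R w\<^sub>i\<close> in absolute value. In both
  cases \<open>1 - \<beta> \<le> \<beta>\<close>, that is \<open>\<beta> \<ge> 1/2\<close>, bounds the new error by \<open>\<beta> R w\<^sub>i\<close>
  (\<open>sign_step_contracts\<close>).

  The class condition speaks only about points of the initial box, so the centres must never
  leave it. Step \<open>j\<close> moves coordinate \<open>i\<close> by exactly \<open>(1 - \<beta>) \<beta>\<^sup>j r\<^sub>0 w\<^sub>i\<close>, and
  these lengths telescope to \<open>(1 - \<beta>\<^sup>k) r\<^sub>0 w\<^sub>i\<close> after \<open>k\<close> steps
  (\<open>cube_sign_dist_start\<close>). The bound on the number of steps
  follows by taking logarithms.\<close>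

lemma weighted_sup_norm_le_iff:
  fixes w u :: "real ^ 'n::finite"
  assumes "\<forall>i. 0 < w $ i"
  shows "weighted_sup_norm w u \<le> R \<longleftrightarrow> (\<forall>i. \<bar>u $ i\<bar> \<le> R * w $ i)"
  using assms unfolding weighted_sup_norm_def
  by (subst Max_le_iff) (auto simp: pos_divide_le_eq)

lemma choose_signs_unit:
  assumes "tie_rule tie"
  shows "\<bar>choose_signs tie h c (sign_answers f x) $ i\<bar> = 1"
proof -
  have "tie h c (sign_answers f x) $ i \<in> {-1, 1}"
    using assms unfolding tie_rule_def by blast
  then show ?thesis
    by (auto simp: choose_signs_def sign_answers_def abs_sgn_eq)
qed

lemma choose_signs_eq_sgn_error:
  assumes "f \<in> class_U xs B" and "x \<in> B" and "x $ i \<noteq> xs $ i"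
  shows "choose_signs tie h c (sign_answers f x) $ i = sgn (x $ i - xs $ i)"
proof -
  have "0 < partial_deriv i f x * (x $ i - xs $ i)"
    using assms unfolding class_U_def by blast
  then show ?thesis
    by (auto simp: choose_signs_def sign_answers_def zero_less_mult_iff)
qed

text \<open>The convergence argument holds for every tie rule and every history, so the history
  can be hidden behind an existential quantifier and the recursion read as one on centres
  only.\<close>

lemma cube_sign_Suc:
  "\<exists>h. \<forall>i. cube_sign \<beta> w tie f c0 r0 (Suc k) $ i =
     cube_sign \<beta> w tie f c0 r0 k $ i - (1 - \<beta>) * (cube_radius \<beta> r0 k * w $ i) *
         choose_signs tie h (cube_sign \<beta> w tie f c0 r0 k)
           (sign_answers f (cube_sign \<beta> w tie f c0 r0 k)) $ i"
  by (rule exI[of _ "fst (cube_sign_state \<beta> w tie f c0 r0 k)"])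
    (simp add: cube_sign_def Let_def case_prod_beta algebra_simps)

lemma cube_sign_dist_start:
  fixes w :: "real ^ 'n::finite"
  assumes "\<forall>i. 0 < w $ i" and "0 \<le> \<beta>" and "\<beta> \<le> 1" and "0 \<le> r0" and "tie_rule tie"
  shows "\<bar>cube_sign \<beta> w tie f c0 r0 k $ i - c0 $ i\<bar> \<le> (1 - \<beta> ^ k) * (r0 * w $ i)"
proof (induction k)
  case 0
  show ?case by (simp add: cube_sign_def)
next
  case (Suc k)
  let ?c = "cube_sign \<beta> w tie f c0 r0"
  obtain h where step: "\<And>i. ?c (Suc k) $ i = ?c k $ i - (1 - \<beta>) * (cube_radius \<beta> r0 k * w $ i)
      * choose_signs tie h (?c k) (sign_answers f (?c k)) $ i"
    using cube_sign_Suc[of \<beta> w tie f c0 r0 k] by blast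
  have "0 \<le> (1 - \<beta>) * (cube_radius \<beta> r0 k * w $ i)"
    using assms by (simp add: cube_radius_def less_imp_le)
  then have "\<bar>?c (Suc k) $ i - ?c k $ i\<bar> = (1 - \<beta>) * (cube_radius \<beta> r0 k * w $ i)"
    using abs_mult[of "(1 - \<beta>) * (cube_radius \<beta> r0 k * w $ i)"]
    by (simp add: step choose_signs_unit[OF assms(5)])
  then have "\<bar>?c (Suc k) $ i - c0 $ i\<bar> \<le>
      (1 - \<beta> ^ k) * (r0 * w $ i) + (1 - \<beta>) * (cube_radius \<beta> r0 k * w $ i)"
    using Suc.IH by linarith
  also have "\<dots> = (1 - \<beta> ^ Suc k) * (r0 * w $ i)"
    by (simp add: cube_radius_def algebra_simps)
  finally show ?case .
qed

corollary cube_sign_in_start_box: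
  fixes w :: "real ^ 'n::finite"
  assumes "\<forall>i. 0 < w $ i" and "0 \<le> \<beta>" and "\<beta> \<le> 1" and "0 \<le> r0" and "tie_rule tie"
  shows "cube_sign \<beta> w tie f c0 r0 k \<in> centered_box c0 (r0 *\<^sub>R w)"
  unfolding centered_box_def
proof (intro CollectI allI)
  fix i
  have "(1 - \<beta> ^ k) * (r0 * w $ i) \<le> r0 * w $ i"
    using assms by (intro mult_left_le_one_le) (auto simp: power_le_one less_imp_le)
  then show "\<bar>cube_sign \<beta> w tie f c0 r0 k $ i - c0 $ i\<bar> \<le> (r0 *\<^sub>R w) $ i"
    using cube_sign_dist_start[OF assms, of f c0 k i] by simp
qed

text \<open>One coordinate of one step: \<open>d\<close> is the error, \<open>\<rho>\<close> the half-width of the box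
  and \<open>s\<close> the chosen sign. For \<open>d = 0\<close> no sign is right, and overshooting by
  \<open>(1 - \<beta>) \<rho>\<close> is harmless exactly because \<open>1 - \<beta> \<le> \<beta>\<close>.\<close>

lemma sign_step_contracts:
  fixes d s \<rho> \<beta> :: real
  assumes "\<bar>d\<bar> \<le> \<rho>" and "\<bar>s\<bar> = 1" and "d \<noteq> 0 \<Longrightarrow> s = sgn d"
    and "1 / 2 \<le> \<beta>" and "\<beta> \<le> 1"
  shows "\<bar>d - (1 - \<beta>) * \<rho> * s\<bar> \<le> \<beta> * \<rho>"
proof -
  have overshoot: "(1 - \<beta>) * \<rho> \<le> \<beta> * \<rho>" and nonneg: "0 \<le> (1 - \<beta>) * \<rho>"
    using assms(1,4,5) by (auto intro!: mult_right_mono)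
  have split: "(1 - \<beta>) * \<rho> = \<rho> - \<beta> * \<rho>"
    by (simp add: algebra_simps)
  consider "d = 0" | "d > 0" | "d < 0" by linarith
  then show ?thesis
  proof cases
    case 1
    then show ?thesis using overshoot nonneg assms(2) by (simp add: abs_mult)
  next
    case 2
    then have "s = 1" using assms(3) by simp
    then have "d - (1 - \<beta>) * \<rho> * s = d - (1 - \<beta>) * \<rho>" by simp
    then show ?thesis using 2 assms(1) overshoot split by linarith
  next
    case 3
    then have "s = -1" using assms(3) by simp
    then have "d - (1 - \<beta>) * \<rho> * s = d + (1 - \<beta>) * \<rho>" by simp
    then show ?thesis using 3 assms(1) overshoot split by linarith
  qed
qed

lemma cube_sign_error_le:
  fixes w :: "real ^ 'n::finite"
  assumes "\<forall>i. 0 < w $ i" and "1 / 2 \<le> \<beta>" and "\<beta> \<le> 1" and "0 \<le> r0"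
    and "xs \<in> centered_box c0 (r0 *\<^sub>R w)"
    and "f \<in> class_U xs (centered_box c0 (r0 *\<^sub>R w))"
    and "tie_rule tie"
  shows "\<bar>cube_sign \<beta> w tie f c0 r0 k $ i - xs $ i\<bar> \<le> cube_radius \<beta> r0 k * w $ i"
proof (induction k)
  case 0
  show ?case
    using assms(5) by (simp add: cube_sign_def cube_radius_def centered_box_def abs_minus_commute)
next
  case (Suc k)
  let ?c = "cube_sign \<beta> w tie f c0 r0"
  obtain h where step: "\<And>i. ?c (Suc k) $ i = ?c k $ i - (1 - \<beta>) * (cube_radius \<beta> r0 k * w $ i)
      * choose_signs tie h (?c k) (sign_answers f (?c k)) $ i"
    using cube_sign_Suc[of \<beta> w tie f c0 r0 k] by blast
  let ?s = "choose_signs tie h (?c k) (sign_answers f (?c k)) $ i"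
  have inside: "?c k \<in> centered_box c0 (r0 *\<^sub>R w)"
    using assms by (intro cube_sign_in_start_box) auto
  have "\<bar>(?c k $ i - xs $ i) - (1 - \<beta>) * (cube_radius \<beta> r0 k * w $ i) * ?s\<bar>
      \<le> \<beta> * (cube_radius \<beta> r0 k * w $ i)"
  proof (rule sign_step_contracts[OF Suc.IH])
    show "\<bar>?s\<bar> = 1" by (rule choose_signs_unit[OF assms(7)])
    show "?s = sgn (?c k $ i - xs $ i)" if "?c k $ i - xs $ i \<noteq> 0"
      using that by (intro choose_signs_eq_sgn_error[OF assms(6) inside]) simp
  qed fact+
  then show ?case
    by (simp add: step cube_radius_def algebra_simps)
qed

lemma cube_radius_le_after_log_steps:
  assumes "0 < \<beta>" and "\<beta> < 1" and "0 < r0" and "0 < \<epsilon>"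
  shows "cube_radius \<beta> r0 (nat \<lceil>ln (r0 / \<epsilon>) / ln (1 / \<beta>)\<rceil>) \<le> \<epsilon>"
proof -
  define K where "K = nat \<lceil>ln (r0 / \<epsilon>) / ln (1 / \<beta>)\<rceil>"
  have "0 < ln (1 / \<beta>)"
    using assms by simp
  moreover have "ln (r0 / \<epsilon>) / ln (1 / \<beta>) \<le> real K"
    unfolding K_def by (rule real_nat_ceiling_ge)
  ultimately have "ln (r0 / \<epsilon>) \<le> real K * ln (1 / \<beta>)"
    by (simp add: pos_divide_le_eq)
  then have "ln (\<beta> ^ K * r0) \<le> ln \<epsilon>"
    using assms by (simp add: ln_mult ln_div ln_realpow)
  then show ?thesis
    using assms by (simp add: cube_radius_def K_def)
qed

theorem theorem2p6:
  fixes w c0 xs :: "real ^ 'n::finite"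
    and \<beta> r0 :: real
    and f :: "real ^ 'n \<Rightarrow> real"
    and tie :: "'n tie_fun"
  assumes "\<forall>i. 0 < w $ i"
    and "1 / 2 \<le> \<beta>" and "\<beta> < 1"
    and "0 < r0"
    and "xs \<in> centered_box c0 (r0 *\<^sub>R w)"
    and "f \<in> class_U xs (centered_box c0 (r0 *\<^sub>R w))"
    and "tie_rule tie"
  shows "(\<forall>k. xs \<in> centered_box (cube_sign \<beta> w tie f c0 r0 k) (cube_radius \<beta> r0 k *\<^sub>R w) \<and>
              weighted_sup_norm w (cube_sign \<beta> w tie f c0 r0 k - xs) \<le> cube_radius \<beta> r0 k) \<and>
         (\<forall>\<epsilon>. 0 < \<epsilon> \<and> \<epsilon> < r0 \<longrightarrow>
              weighted_sup_norm w
                (cube_sign \<beta> w tie f c0 r0 (nat \<lceil>ln (r0 / \<epsilon>) / ln (1 / \<beta>)\<rceil>) - xs) \<le> \<epsilon>)"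
proof -
  have error: "\<bar>cube_sign \<beta> w tie f c0 r0 k $ i - xs $ i\<bar> \<le> cube_radius \<beta> r0 k * w $ i" for k i
    using assms by (intro cube_sign_error_le) auto
  then have box: "xs \<in> centered_box (cube_sign \<beta> w tie f c0 r0 k) (cube_radius \<beta> r0 k *\<^sub>R w)" for k
    by (simp add: centered_box_def abs_minus_commute)
  have norm: "weighted_sup_norm w (cube_sign \<beta> w tie f c0 r0 k - xs) \<le> cube_radius \<beta> r0 k" for k
    using error by (simp add: weighted_sup_norm_le_iff[OF assms(1)])
  have "weighted_sup_norm w
      (cube_sign \<beta> w tie f c0 r0 (nat \<lceil>ln (r0 / \<epsilon>) / ln (1 / \<beta>)\<rceil>) - xs) \<le> \<epsilon>" if "0 < \<epsilon>" for \<epsilon>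
    using norm cube_radius_le_after_log_steps[of \<beta> r0 \<epsilon>] assms(2-4) that
    by (meson less_le_trans order_trans zero_less_divide_1_iff zero_less_numeral)
  then show ?thesis
    using box norm by blast
qed

end
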